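(* For every $n\geq 3$, $M_\Theta(n)=2n+1$. More precisely, let $e_1,\ldots,e_n$ be the standard basis of $\mathbb{Z}_2^n$ and $J=e_1+\cdots+e_n$. (i) If $n\ge 3$ is odd, then $$S=\{e_1,\ldots,e_n\}\cup\{J+e_1,\ldots,J+e_n\}\cup\{J\}$$ has the $\Theta$-property. (ii) If $n\geq 6$ is even, then $$S=\{e_1,\ldots,e_n\}\cup\{e_1+e_2,\ e_1+e_3,\ e_2+e_3,\ e_4+\cdots+e_n\}\cup\{J+e_k:4\leq k\leq n\}$$ has the $\Theta$-property. In both cases (i) and (ii), $0\notin S$ and $|S|=2n+1$. (iii) For $n=4$, the set $$S=\{e_1,e_2,e_3,e_4\}\cup\{J+e_1,J+e_2,J+e_3,J+e_4\}\cup\{0\}$$ has the $\Theta$-property and has size $9$.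
   Context: $\Theta$-property: a subset $S\subseteq\mathbb{Z}_2^n$ has the $\Theta$-property if for any three pairwise disjoint subsets of $S$ whose element sums are equal, at least two of the three subsets have even size. (An empty subset is allowed; its sum is $0$.) $M_\Theta(n)$ denotes the maximum of $|S|$ over all subsets $S\subseteq\mathbb{Z}_2^n$ that generate $\mathbb{Z}_2^n$ and have the $\Theta$-property; here $S$ is allowed to contain $0$. *)

theory Defs
  imports
    "HOL-Library.Z2"
    "HOL-Library.Function_Algebras"
    "HOL-Computational_Algebra.Group_Closure"
begin

text \<open>
  The group \<open>\<int>\<^sub>2\<^sup>n\<close> is realised as the set of functions \<open>nat \<Rightarrow> bit\<close> that vanish outside
  the coordinates \<open>1, \<dots>, n\<close>; addition and \<open>0\<close> are the pointwise ones.
\<close>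

definition Z2n :: "nat \<Rightarrow> (nat \<Rightarrow> bit) set"
  where "Z2n n = {v. \<forall>i. i \<notin> {1..n} \<longrightarrow> v i = 0}"

definition std_vec :: "nat \<Rightarrow> nat \<Rightarrow> bit"
  where "std_vec k = (\<lambda>i. if i = k then 1 else 0)"

definition theta_property :: "nat \<Rightarrow> (nat \<Rightarrow> bit) set \<Rightarrow> bool"
  where "theta_property n S \<longleftrightarrow>
    S \<subseteq> Z2n n \<and>
    (\<forall>A B C. A \<subseteq> S \<and> B \<subseteq> S \<and> C \<subseteq> S \<and>
        A \<inter> B = {} \<and> A \<inter> C = {} \<and> B \<inter> C = {} \<and>
        \<Sum>A = \<Sum>B \<and> \<Sum>B = \<Sum>C \<longrightarrow>
      (even (card A) \<and> even (card B)) \<or>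
      (even (card A) \<and> even (card C)) \<or>
      (even (card B) \<and> even (card C)))"

text \<open>
  \<open>group_closure S\<close> is the subgroup generated by \<open>S\<close>. The maximum ranges over a finite set of
  numbers, since \<open>Z2n n\<close> is finite, and it is never over the empty set: disjoint subsets of the
  standard basis with equal sums are all empty, so the standard basis itself qualifies.
\<close>

definition M_Theta :: "nat \<Rightarrow> nat"
  where "M_Theta n = Max {card S |S. group_closure S = Z2n n \<and> theta_property n S}"

lemma finite_Z2n: "finite (Z2n n)"
proof -
  have "Z2n n \<subseteq> {v. \<forall>i. (i \<in> {1..n} \<longrightarrow> v i \<in> {0, 1}) \<and> (i \<notin> {1..n} \<longrightarrow> v i = 0)}"
    by (auto simp: Z2n_def)
  then show ?thesis
    by (rule finite_subset) (intro finite_set_of_finite_funs, auto)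
qed

lemma finite_theta_cards:
  "finite {card S |S. group_closure S = Z2n n \<and> theta_property n S}"
proof -
  have "{card S |S. group_closure S = Z2n n \<and> theta_property n S} \<subseteq> card ` Pow (Z2n n)"
    by (auto simp: theta_property_def)
  then show ?thesis
    by (rule finite_subset) (simp add: finite_Z2n)
qed

end

theory Submission
  imports Defs
begin

text \<open>
  Disjoint \<open>A\<close>, \<open>B\<close>, \<open>C\<close> with equal sums correspond to the two zero-sum sets \<open>X = A \<union> B\<close> and
  \<open>Y = A \<union> C\<close>, and the \<open>\<Theta>\<close>-property says that \<open>card (X \<inter> Y)\<close> is odd exactly if \<open>card X\<close> and
  \<open>card Y\<close> both are. So it holds iff the zero-sum subsets of \<open>S\<close>, viewed as a binary code and
  extended by a parity bit, form a self-orthogonal code of length \<open>card S + 1\<close>. Its dimension is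
  at least \<open>card S - n\<close> and at most half the length, whence \<open>card S \<le> 2 * n + 1\<close>. In case of
  equality the code is self-dual, so the property can instead be tested on the dual code, which
  is spanned by the \<open>n\<close> coordinate rows and the all-ones word: it suffices that \<open>s i * s j\<close> sums
  to \<open>0\<close> over \<open>S\<close> for all \<open>i\<close>, \<open>j\<close>.
\<close>

section \<open>Parity and sums in characteristic two\<close>

text \<open>These rules would turn the field operations into bit operations.\<close>

declare add_bit_eq_xor [simp del] mult_bit_eq_and [simp del]

lemma bit_add_self: "a + a = 0" for a :: bit
  by (cases a) simp_all

lemma bit_fun_add_self: "v + v = 0" for v :: "'a \<Rightarrow> bit"
  by (simp add: fun_eq_iff bit_add_self)

lemma bit_fun_diff_eq_add: "v - w = v + w" for v w :: "'a \<Rightarrow> bit"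
  by (simp add: fun_eq_iff)

lemma bit_fun_add_eq_0_iff: "v + w = 0 \<longleftrightarrow> v = w" for v w :: "'a \<Rightarrow> bit"
  by (metis bit_fun_diff_eq_add right_minus_eq)

text \<open>The part over \<open>A \<inter> B\<close> enters the right-hand side twice and cancels.
  Subset sums thus turn symmetric differences into sums.\<close>

lemma sum_sym_diff:
  fixes f :: "'a \<Rightarrow> 'b::ab_group_add"
  assumes "\<And>x::'b. x + x = 0" and "finite A" "finite B"
  shows "sum f (sym_diff A B) = sum f A + sum f B"
proof -
  have "sum f (sym_diff A B) = sum f (A - B) + sum f (B - A)"
    using assms by (intro sum.union_disjoint) auto
  moreover have "sum f A = sum f (A \<inter> B) + sum f (A - B)"
    using assms by (simp add: sum.Int_Diff)
  moreover have "sum f B = sum f (A \<inter> B) + sum f (B - A)"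
    using assms by (metis sum.Int_Diff inf_commute)
  moreover have "sum f (A \<inter> B) + x + (sum f (A \<inter> B) + y) = x + y" for x y
    using assms(1) by (metis add.assoc add.commute add.left_neutral)
  ultimately show ?thesis
    by simp
qed

lemma even_card_sym_diff:
  assumes "finite A" "finite B"
  shows "even (card (sym_diff A B)) \<longleftrightarrow> (even (card A) \<longleftrightarrow> even (card B))"
proof -
  have "card (sym_diff A B) = card (A - B) + card (B - A)"
    using assms by (intro card_Un_disjoint) auto
  moreover have "card A = card (A \<inter> B) + card (A - B)"
    using assms by (metis card_Int_Diff)
  moreover have "card B = card (A \<inter> B) + card (B - A)"
    using assms by (metis card_Int_Diff inf_commute)
  ultimately show ?thesis
    by auto
qed

lemma even_card_iff_sum: "even (card A) \<longleftrightarrow> (\<Sum>a\<in>A. 1 :: bit) = 0"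
proof (induction A rule: infinite_finite_induct)
  case (insert x A)
  then show ?case
    by (cases "\<Sum>a\<in>A. 1 :: bit") (simp_all add: bit_add_self)
qed simp_all

section \<open>Self-orthogonal codes and zero-sum subsets\<close>

text \<open>Toggling a fixed element of \<open>c\<close> permutes \<open>Pow U\<close> and flips
  every sign, so the sum equals its own negative. This is the orthogonality of characters.\<close>

lemma sign_sum_Pow:
  assumes "finite U" "c \<subseteq> U" "c \<noteq> {}"
  shows "(\<Sum>T\<in>Pow U. (-1) ^ card (c \<inter> T) :: int) = 0"
proof -
  obtain x where x: "x \<in> c" using assms by auto
  have fin: "finite c" using assms finite_subset by blast
  have "bij_betw (\<lambda>T. sym_diff T {x}) (Pow U) (Pow U)"
    using x assms by (intro bij_betw_byWitness [where f' = "\<lambda>T. sym_diff T {x}"]) auto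
  then have "(\<Sum>T\<in>Pow U. (-1) ^ card (c \<inter> T) :: int)
      = (\<Sum>T\<in>Pow U. (-1) ^ card (c \<inter> sym_diff T {x}))"
    by (rule sum.reindex_bij_betw [symmetric])
  also have "\<dots> = (\<Sum>T\<in>Pow U. - ((-1) ^ card (c \<inter> T)))"
  proof (rule sum.cong)
    fix T
    have "c \<inter> sym_diff T {x} = sym_diff (c \<inter> T) {x}" using x by auto
    then have "even (card (c \<inter> sym_diff T {x})) \<longleftrightarrow> odd (card (c \<inter> T))"
      using even_card_sym_diff [of "c \<inter> T" "{x}"] fin by simp
    then show "(-1) ^ card (c \<inter> sym_diff T {x}) = - ((-1) ^ card (c \<inter> T) :: int)"
      by (cases "even (card (c \<inter> T))") auto
  qed simp
  finally show ?thesis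
    by (simp add: sum_negf)
qed

lemma sign_card_sym_diff:
  assumes "finite A" "finite B"
  shows "(-1) ^ card (sym_diff A B) = ((-1) ^ card A * (-1) ^ card B :: int)"
  using even_card_sym_diff [OF assms]
  by (cases "even (card A)"; cases "even (card B)") auto

text \<open>Bessel's inequality for the pairwise orthogonal characters indexed by \<open>C\<close>.\<close>

lemma self_orthogonal_code_card:
  assumes "finite U" "C \<subseteq> Pow U"
    and orth: "\<And>c d. c \<in> C \<Longrightarrow> d \<in> C \<Longrightarrow> even (card (c \<inter> d))"
  shows "(card C)\<^sup>2 \<le> 2 ^ card U"
proof (cases "C = {}")
  case False
  let ?F = "\<lambda>T. \<Sum>c\<in>C. (-1) ^ card (c \<inter> T) :: int"
  have finC: "finite C" and fin: "\<And>c. c \<in> C \<Longrightarrow> finite c"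
    using assms(1,2) by (auto intro: finite_subset)
  \<comment> \<open>For a word \<open>T\<close> of \<open>C\<close> every
    \<open>c \<inter> T\<close> has even size, so \<open>?F T\<close> is \<open>card C\<close>;
    summing its square over \<open>C\<close> gives the cube.\<close>
  have "int (card C) ^ 3 = (\<Sum>T\<in>C. (?F T)\<^sup>2)"
    using orth by (simp add: power2_eq_square power3_eq_cube)
  also have "\<dots> \<le> (\<Sum>T\<in>Pow U. (?F T)\<^sup>2)"
    using assms(1,2) by (intro sum_mono2) auto
  also have "\<dots> = (\<Sum>T\<in>Pow U. \<Sum>c\<in>C. \<Sum>d\<in>C. (-1) ^ card (sym_diff c d \<inter> T))"
  proof (rule sum.cong)
    fix T
    have "(-1) ^ card (c \<inter> T) * (-1) ^ card (d \<inter> T) = ((-1) ^ card (sym_diff c d \<inter> T) :: int)"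
      if "c \<in> C" "d \<in> C" for c d
    proof -
      have "sym_diff c d \<inter> T = sym_diff (c \<inter> T) (d \<inter> T)" by auto
      then show ?thesis using fin that by (simp add: sign_card_sym_diff)
    qed
    then show "(?F T)\<^sup>2 = (\<Sum>c\<in>C. \<Sum>d\<in>C. (-1) ^ card (sym_diff c d \<inter> T))"
      by (simp add: power2_eq_square sum_product)
  qed simp
  also have "\<dots> = (\<Sum>c\<in>C. \<Sum>d\<in>C. \<Sum>T\<in>Pow U. (-1) ^ card (sym_diff c d \<inter> T))"
    by (subst sum.swap) (intro sum.cong sum.swap refl)
  \<comment> \<open>Orthogonality: distinct words have a nonempty symmetric difference, so only the
    diagonal survives.\<close>
  also have "\<dots> = (\<Sum>c\<in>C. \<Sum>d\<in>C. if c = d then 2 ^ card U else 0)"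
  proof (intro sum.cong refl)
    fix c d assume "c \<in> C" "d \<in> C"
    then have "sym_diff c d \<subseteq> U" using assms(2) by auto
    moreover have "sym_diff c d \<noteq> {}" if "c \<noteq> d" using that by auto
    ultimately show "(\<Sum>T\<in>Pow U. (-1) ^ card (sym_diff c d \<inter> T))
        = (if c = d then 2 ^ card U else 0 :: int)"
      using sign_sum_Pow [OF assms(1), of "sym_diff c d"] assms(1) by (simp add: card_Pow)
  qed
  also have "\<dots> = int (card C) * 2 ^ card U"
    using finC by simp
  finally have "int (card C) * (int (card C))\<^sup>2 \<le> int (card C) * 2 ^ card U"
    by (simp add: power3_eq_cube power2_eq_square)
  moreover have "int (card C) > 0"
    using False finC by (simp add: card_gt_0_iff)
  ultimately have "int ((card C)\<^sup>2) \<le> int (2 ^ card U)"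
    by (simp add: mult_le_cancel_left_pos)
  then show ?thesis
    by (simp only: of_nat_le_iff)
qed simp

text \<open>This is the kernel of the map from \<open>T\<close> to \<open>\<Sum>T\<close>, that is,
  the code whose parity-check matrix has the elements of \<open>S\<close> as columns.\<close>

definition zero_sum_subsets :: "'a::ab_group_add set \<Rightarrow> 'a set set"
  where "zero_sum_subsets S = {X. X \<subseteq> S \<and> \<Sum>X = 0}"

text \<open>Rank-nullity in terms of cardinalities: every nonempty fibre of the subset-sum map is a
  translate of its kernel, by symmetric difference with any one \<open>T\<close> in the
  fibre.\<close>

lemma card_subset_sums:
  fixes S :: "'a::ab_group_add set"
  assumes "\<And>x::'a. x + x = 0" and "finite S"
  shows "card (Sum ` Pow S) * card (zero_sum_subsets S) = 2 ^ card S"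
proof -
  let ?fibre = "\<lambda>v. {T \<in> Pow S. \<Sum>T = v}"
  have "card (?fibre v) = card (zero_sum_subsets S)" if "v \<in> Sum ` Pow S" for v
  proof -
    from that obtain T where T: "T \<subseteq> S" "\<Sum>T = v" by blast
    have fin: "finite X" if "X \<subseteq> S" for X using that assms(2) finite_subset by blast
    have sum: "\<Sum>(sym_diff X T) = \<Sum>X + v" if "X \<subseteq> S" for X
      using sum_sym_diff [OF assms(1) fin fin, of X T "\<lambda>x. x"] that T by simp
    have "bij_betw (\<lambda>X. sym_diff X T) (?fibre v) (zero_sum_subsets S)"
    proof (intro bij_betw_byWitness [where f' = "\<lambda>X. sym_diff X T"])
      show "(\<lambda>X. sym_diff X T) ` ?fibre v \<subseteq> zero_sum_subsets S"
        using sum T assms(1) by (auto simp: zero_sum_subsets_def)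
      show "(\<lambda>X. sym_diff X T) ` zero_sum_subsets S \<subseteq> ?fibre v"
        using sum T by (auto simp: zero_sum_subsets_def)
    qed auto
    then show ?thesis by (rule bij_betw_same_card)
  qed
  moreover have "card (Pow S) = (\<Sum>v\<in>Sum ` Pow S. card (?fibre v))"
    using sum.image_gen [of "Pow S" "\<lambda>_. 1 :: nat" Sum] assms(2) by simp
  ultimately show ?thesis
    using assms(2) by (simp add: card_Pow)
qed

text \<open>Zero-sum sets \<open>X\<close>, \<open>Y\<close> give the triple
  \<open>X \<inter> Y\<close>, \<open>X - Y\<close>, \<open>Y - X\<close>, and a triple gives back
  \<open>A \<union> B\<close> and \<open>A \<union> C\<close>, which meet in \<open>A\<close>.
  Expressed through these sizes, "at least two of three are even" is the parity condition stated
  here.\<close>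

lemma theta_property_iff:
  assumes "finite S"
  shows "theta_property n S \<longleftrightarrow> S \<subseteq> Z2n n \<and>
    (\<forall>X\<in>zero_sum_subsets S. \<forall>Y\<in>zero_sum_subsets S.
      even (card (X \<inter> Y)) \<longleftrightarrow> even (card X) \<or> even (card Y))"
    (is "_ \<longleftrightarrow> _ \<and> ?R")
proof
  assume th: "theta_property n S"
  show "S \<subseteq> Z2n n \<and> ?R"
  proof (intro conjI ballI)
    fix X Y
    assume XY: "X \<in> zero_sum_subsets S" "Y \<in> zero_sum_subsets S"
    have fin: "finite X" "finite Y"
      using XY assms by (auto simp: zero_sum_subsets_def intro: finite_subset)
    have "\<Sum>(X - Y) = \<Sum>(X \<inter> Y)" "\<Sum>(Y - X) = \<Sum>(X \<inter> Y)"
      using XY sum.Int_Diff [OF fin(1), of "\<lambda>x. x" Y] sum.Int_Diff [OF fin(2), of "\<lambda>x. x" X]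
      by (simp_all add: zero_sum_subsets_def Int_commute bit_fun_add_eq_0_iff)
    then have "(even (card (X \<inter> Y)) \<and> even (card (X - Y))) \<or>
        (even (card (X \<inter> Y)) \<and> even (card (Y - X))) \<or>
        (even (card (X - Y)) \<and> even (card (Y - X)))"
      using th [unfolded theta_property_def, THEN conjunct2, rule_format, of "X \<inter> Y" "X - Y" "Y - X"]
        XY unfolding zero_sum_subsets_def by auto
    moreover have "card X = card (X \<inter> Y) + card (X - Y)" "card Y = card (X \<inter> Y) + card (Y - X)"
      using card_Int_Diff [OF fin(1), of Y] card_Int_Diff [OF fin(2), of X] by (auto simp: Int_commute)
    ultimately show "even (card (X \<inter> Y)) \<longleftrightarrow> even (card X) \<or> even (card Y)"
      by auto
  qed (use th in \<open>simp add: theta_property_def\<close>)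
next
  assume R: "S \<subseteq> Z2n n \<and> ?R"
  show "theta_property n S"
    unfolding theta_property_def
  proof (intro conjI allI impI; (elim conjE)?)
    fix A B C
    assume *: "A \<subseteq> S" "B \<subseteq> S" "C \<subseteq> S" "A \<inter> B = {}" "A \<inter> C = {}" "B \<inter> C = {}"
      "\<Sum>A = \<Sum>B" "\<Sum>B = \<Sum>C"
    have fin: "finite A" "finite B" "finite C"
      using * assms by (auto intro: finite_subset)
    have "A \<union> B \<in> zero_sum_subsets S" "A \<union> C \<in> zero_sum_subsets S"
      using * fin by (auto simp: zero_sum_subsets_def sum.union_disjoint bit_fun_add_self)
    moreover have "(A \<union> B) \<inter> (A \<union> C) = A"
      using * by auto
    ultimately have "even (card A) \<longleftrightarrow> even (card (A \<union> B)) \<or> even (card (A \<union> C))"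
      using R by metis
    then show "(even (card A) \<and> even (card B)) \<or> (even (card A) \<and> even (card C)) \<or>
        (even (card B) \<and> even (card C))"
      using * fin by (auto simp: card_Un_disjoint)
  qed (use R in auto)
qed

section \<open>The upper bound by counting zero-sum subsets\<close>

lemma card_Z2n: "card (Z2n n) = 2 ^ n"
proof -
  have "bij_betw (\<lambda>v. {i. v i = 1}) (Z2n n) (Pow {1..n})"
    by (intro bij_betw_byWitness [where f' = "\<lambda>I i. if i \<in> I then 1 else 0"])
      (auto simp: Z2n_def fun_eq_iff)
  then have "card (Z2n n) = card (Pow {1..n})"
    by (rule bij_betw_same_card)
  then show ?thesis
    by (simp add: card_Pow)
qed

lemma Z2n_add: "v \<in> Z2n n \<Longrightarrow> w \<in> Z2n n \<Longrightarrow> v + w \<in> Z2n n"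
  by (auto simp: Z2n_def)

lemma Z2n_sum: "(\<And>x. x \<in> A \<Longrightarrow> f x \<in> Z2n n) \<Longrightarrow> sum f A \<in> Z2n n"
  by (induction A rule: infinite_finite_induct) (auto simp: Z2n_add, simp_all add: Z2n_def)

lemma theta_property_card_le:
  assumes "theta_property n S"
  shows "card S \<le> 2 * n + 1"
proof -
  let ?Z = "zero_sum_subsets S"
  have S: "S \<subseteq> Z2n n"
    using assms by (simp add: theta_property_def)
  then have fin: "finite S"
    using finite_Z2n finite_subset by blast
  \<comment> \<open>\<open>None\<close> is the parity coordinate: it lies in both extended words
    exactly if both sizes are odd, which is when \<open>X \<inter> Y\<close> has odd size. All
    intersections thereby become even.\<close>
  define ext where "ext = (\<lambda>X :: (nat \<Rightarrow> bit) set.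
    Some ` X \<union> (if even (card X) then {} else {None}))"
  let ?U = "insert None (Some ` S)"
  have "card (ext X \<inter> ext Y) = card (X \<inter> Y) + of_bool (odd (card X) \<and> odd (card Y))"
    if "X \<in> ?Z" "Y \<in> ?Z" for X Y
  proof -
    have "ext X \<inter> ext Y
        = Some ` (X \<inter> Y) \<union> (if odd (card X) \<and> odd (card Y) then {None} else {})"
      by (auto simp: ext_def)
    moreover have "finite (X \<inter> Y)"
      using that fin by (auto simp: zero_sum_subsets_def intro: finite_subset)
    ultimately show ?thesis
      by (subst card_Un_disjoint [symmetric] | simp add: card_image)+ 
  qed
  then have "even (card (ext X \<inter> ext Y))" if "X \<in> ?Z" "Y \<in> ?Z" for X Y
    using assms that unfolding theta_property_iff [OF fin] by auto
  moreover have "ext ` ?Z \<subseteq> Pow ?U"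
    by (auto simp: ext_def zero_sum_subsets_def split: if_splits)
  ultimately have "(card (ext ` ?Z))\<^sup>2 \<le> 2 ^ card ?U"
    using fin by (intro self_orthogonal_code_card) blast+
  moreover have "inj_on ext ?Z"
    by (rule inj_on_inverseI [where g = "\<lambda>V. {x. Some x \<in> V}"]) (auto simp: ext_def)
  moreover have "card ?U = card S + 1"
    using fin by (simp add: card_image)
  ultimately have Z: "(card ?Z)\<^sup>2 \<le> 2 ^ (card S + 1)"
    by (simp only: card_image)
  have "Sum ` Pow S \<subseteq> Z2n n"
    using S by (auto intro!: Z2n_sum)
  then have "card (Sum ` Pow S) \<le> 2 ^ n"
    using card_mono [OF finite_Z2n] card_Z2n by metis
  then have "2 ^ card S \<le> 2 ^ n * card ?Z"
    using card_subset_sums [OF bit_fun_add_self fin] by (metis mult_le_mono1)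
  \<comment> \<open>Squaring makes the bound on \<open>(card ?Z)\<^sup>2\<close> applicable without
    halving the exponent \<open>card S + 1\<close>.\<close>
  then have "(2 ^ card S)\<^sup>2 \<le> (2 ^ n * card ?Z)\<^sup>2"
    by (rule power_mono) simp
  also have "\<dots> \<le> 2 ^ (2 * n) * 2 ^ (card S + 1)"
    using Z by (simp add: power_mult_distrib mult.commute flip: power_mult)
  finally have "(2::nat) ^ (2 * card S) \<le> 2 ^ (2 * n + (card S + 1))"
    by (simp add: power_add ac_simps flip: power_mult)
  then have "2 * card S \<le> 2 * n + (card S + 1)"
    by (rule power_le_imp_le_exp [rotated]) simp
  then show ?thesis
    by simp
qed

section \<open>A criterion for spanning sets of maximal size\<close>

lemma sum_fun_apply: "(\<Sum>a\<in>A. f a) i = (\<Sum>a\<in>A. f a i)"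
  for f :: "'a \<Rightarrow> 'b \<Rightarrow> 'c::comm_monoid_add"
  by (induction A rule: infinite_finite_induct) auto

lemma bit_mult_self: "a * a = a" for a :: bit
  by (cases a) simp_all

lemma group_closure_sum_mem:
  "(\<And>x. x \<in> A \<Longrightarrow> f x \<in> group_closure S) \<Longrightarrow> sum f A \<in> group_closure S"
  by (induction A rule: infinite_finite_induct) (auto intro: group_closure_add)

text \<open>Subset sums are closed under differences, since in characteristic two the difference of
  two of them is the sum over the symmetric difference.\<close>

lemma subset_sums_eq_group_closure:
  fixes S :: "('a \<Rightarrow> bit) set"
  assumes "finite S"
  shows "Sum ` Pow S = group_closure S"
proof (intro equalityI subsetI)
  fix v
  assume "v \<in> Sum ` Pow S"
  then show "v \<in> group_closure S"
    by (auto intro!: group_closure_sum_mem intro: group_closure.base)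
next
  fix v
  assume "v \<in> group_closure S"
  then show "v \<in> Sum ` Pow S"
  proof induction
    case (base s)
    then consider "s = 0" | "s \<in> S" by blast
    then show ?case
    proof cases
      case 1
      then show ?thesis by (intro image_eqI [of _ _ "{}"]) simp_all
    next
      case 2
      then show ?thesis by (intro image_eqI [of _ _ "{s}"]) simp_all
    qed
  next
    case (diff s t)
    then obtain A B where AB: "A \<subseteq> S" "B \<subseteq> S" "s = \<Sum>A" "t = \<Sum>B" by blast
    then have "finite A" "finite B" using assms finite_subset by blast+
    then have "s - t = \<Sum>(sym_diff A B)"
      using AB sum_sym_diff [of A B "\<lambda>x. x"] by (simp add: bit_fun_diff_eq_add bit_fun_add_self)
    then show ?case using AB by (intro image_eqI [of _ _ "sym_diff A B"]) auto
  qed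
qed

lemma sum_std_vec_apply: "finite K \<Longrightarrow> (\<Sum>k\<in>K. std_vec k) i = of_bool (i \<in> K)"
  by (simp add: sum_fun_apply std_vec_def)

lemma std_vec_in_Z2n: "k \<in> {1..n} \<Longrightarrow> std_vec k \<in> Z2n n"
  by (auto simp: Z2n_def std_vec_def)

lemma group_closure_eq_Z2nI:
  assumes "S \<subseteq> Z2n n" "\<And>k. k \<in> {1..n} \<Longrightarrow> std_vec k \<in> S"
  shows "group_closure S = Z2n n"
proof (intro equalityI subsetI)
  fix v
  assume "v \<in> group_closure S"
  then show "v \<in> Z2n n"
    using assms(1) by induction (auto simp: Z2n_def subset_iff)
next
  fix v
  assume "v \<in> Z2n n"
  then have "v = (\<Sum>k\<in>{k \<in> {1..n}. v k = 1}. std_vec k)"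
    by (auto simp: fun_eq_iff sum_std_vec_apply Z2n_def)
  also have "\<dots> \<in> group_closure S"
    using assms(2) by (intro group_closure_sum_mem) (auto intro: group_closure.base)
  finally show "v \<in> group_closure S" .
qed

text \<open>
  The sets \<open>cut (a, b)\<close> are the words of the dual code; there are as many of them as zero-sum
  subsets.
\<close>

lemma theta_propertyI:
  assumes span: "group_closure S = Z2n n" and card: "card S = 2 * n + 1"
    and orth: "\<And>i j. (\<Sum>s\<in>S. s i * s j) = 0"
  shows "theta_property n S"
proof -
  \<comment> \<open>A pair \<open>(a, b)\<close> encodes the affine functional
    \<open>ip a s + b\<close>: the entries of \<open>a\<close> select coordinate rows and
    \<open>b\<close> selects the all-ones word. \<open>cut\<close> takes its support on
    \<open>S\<close>.\<close>
  define ip :: "(nat \<Rightarrow> bit) \<Rightarrow> (nat \<Rightarrow> bit) \<Rightarrow> bit"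
    where "ip a s = (\<Sum>i\<in>{1..n}. a i * s i)" for a s
  define cut where "cut = (\<lambda>(a, b). {s \<in> S. ip a s + b = 1})"
  let ?Z = "zero_sum_subsets S"
  have S: "S \<subseteq> Z2n n"
    using span group_closure.base by blast
  then have fin: "finite S"
    using finite_Z2n finite_subset by blast
  \<comment> \<open>Here the oddness of \<open>card S\<close> enters; it is what makes
    \<open>b\<close> the parity of \<open>cut (a, b)\<close> below.\<close>
  have one: "(\<Sum>s\<in>S. 1 :: bit) = 1"
    using card even_card_iff_sum [of S] by simp
  have coord: "(\<Sum>s\<in>S. s j) = 0" for j
    using orth [of j j] by (simp add: bit_mult_self)
  have ip_coord: "(\<Sum>s\<in>S. ip a s * s j) = 0" for a j
  proof -
    have "(\<Sum>s\<in>S. ip a s * s j) = (\<Sum>i\<in>{1..n}. \<Sum>s\<in>S. a i * (s i * s j))"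
      unfolding ip_def sum_distrib_right by (subst sum.swap) (simp add: mult.assoc)
    then show ?thesis
      by (simp add: orth flip: sum_distrib_left)
  qed
  have ip_sum: "(\<Sum>s\<in>S. ip a s) = 0" for a
  proof -
    have "(\<Sum>s\<in>S. ip a s) = (\<Sum>i\<in>{1..n}. \<Sum>s\<in>S. a i * s i)"
      unfolding ip_def by (rule sum.swap)
    then show ?thesis
      by (simp add: coord flip: sum_distrib_left)
  qed
  have ip_ip: "(\<Sum>s\<in>S. ip a s * ip c s) = 0" for a c
  proof -
    have "(\<Sum>s\<in>S. ip a s * ip c s) = (\<Sum>s\<in>S. \<Sum>i\<in>{1..n}. c i * (ip a s * s i))"
      unfolding ip_def [of c] sum_distrib_left by (simp add: ac_simps)
    also have "\<dots> = (\<Sum>i\<in>{1..n}. \<Sum>s\<in>S. c i * (ip a s * s i))"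
      by (rule sum.swap)
    finally show ?thesis
      by (simp add: ip_coord flip: sum_distrib_left)
  qed
  have cut_sum: "(\<Sum>s\<in>cut (a, b). g s) = (\<Sum>s\<in>S. (ip a s + b) * g s)" for a b and g :: "_ \<Rightarrow> bit"
  proof -
    have "(\<Sum>s\<in>cut (a, b). g s) = (\<Sum>s\<in>S. if ip a s + b = 1 then g s else 0)"
      using fin by (simp add: cut_def sum.inter_filter)
    also have "\<dots> = (\<Sum>s\<in>S. (ip a s + b) * g s)"
      by (intro sum.cong refl) auto
    finally show ?thesis .
  qed
  have cut_card: "even (card (cut (a, b))) \<longleftrightarrow> b = 0" for a b
  proof -
    have "(\<Sum>s\<in>S. (ip a s + b) * 1) = (\<Sum>s\<in>S. ip a s) + b * (\<Sum>s\<in>S. 1)"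
      by (simp only: mult_1_right sum.distrib sum_distrib_left)
    then show ?thesis
      unfolding even_card_iff_sum cut_sum by (simp only: ip_sum one) simp
  qed
  have cut_zero_sum: "cut (a, b) \<in> ?Z" for a b
  proof -
    have "\<Sum>(cut (a, b)) j = 0" for j
      unfolding sum_fun_apply cut_sum
      by (simp add: distrib_right sum.distrib ip_coord coord flip: sum_distrib_left)
    then show ?thesis
      by (auto simp: zero_sum_subsets_def cut_def)
  qed
  have cut_Int: "even (card (cut (a, b) \<inter> cut (c, d))) \<longleftrightarrow> b * d = 0" for a b c d
  proof -
    have "(\<Sum>s\<in>cut (a, b) \<inter> cut (c, d). 1 :: bit) = (\<Sum>s\<in>cut (a, b). ip c s + d)"
    proof -
      have "(\<Sum>s\<in>cut (a, b) \<inter> cut (c, d). 1 :: bit)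
          = (\<Sum>s\<in>cut (a, b). if s \<in> cut (c, d) then 1 else 0)"
        using fin by (intro sum.inter_restrict) (simp add: cut_def)
      also have "\<dots> = (\<Sum>s\<in>cut (a, b). ip c s + d)"
        by (intro sum.cong refl) (auto simp: cut_def)
      finally show ?thesis .
    qed
    also have "\<dots> = (\<Sum>s\<in>S. ip a s * ip c s) + b * (\<Sum>s\<in>S. ip c s) + d * (\<Sum>s\<in>S. ip a s)
        + b * d * (\<Sum>s\<in>S. 1)"
      unfolding cut_sum sum_distrib_left sum.distrib [symmetric]
      by (intro sum.cong refl) (simp add: algebra_simps)
    also have "\<dots> = b * d"
      by (simp only: ip_ip ip_sum one) simp
    finally show ?thesis
      by (simp add: even_card_iff_sum)
  qed
  \<comment> \<open>The parity of the cut recovers \<open>b\<close>. Then \<open>ip a\<close> and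
    \<open>ip c\<close> agree on \<open>S\<close>, hence on the whole span, and evaluating them at
    the standard basis recovers \<open>a\<close>.\<close>
  have "inj_on cut (Z2n n \<times> {0, 1})"
  proof (rule inj_onI, clarify)
    fix a b c d
    assume ac: "a \<in> Z2n n" "c \<in> Z2n n" and eq: "cut (a, b) = cut (c, d)"
    have "b = 0 \<longleftrightarrow> d = 0"
      using cut_card eq by metis
    then have bd: "b = d"
      by (cases b; cases d) auto
    have "ip a s = ip c s" if "s \<in> S" for s
    proof -
      have "ip a s + b = 1 \<longleftrightarrow> ip c s + b = 1"
        using that eq bd by (auto simp: cut_def)
      then show ?thesis
        by (cases b; cases "ip a s"; cases "ip c s") auto
    qed
    moreover have "ip a (\<Sum>T) = (\<Sum>s\<in>T. ip a s)" for a T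
      unfolding ip_def sum_fun_apply sum_distrib_left by (rule sum.swap)
    ultimately have "ip a (\<Sum>T) = ip c (\<Sum>T)" if "T \<subseteq> S" for T
      using that by (simp add: subset_iff)
    then have "ip a v = ip c v" if "v \<in> Sum ` Pow S" for v
      using that by (elim imageE) simp
    then have "ip a v = ip c v" if "v \<in> Z2n n" for v
      using that by (simp only: span subset_sums_eq_group_closure [OF fin])
    then have "ip a (std_vec k) = ip c (std_vec k)" if "k \<in> {1..n}" for k
      using that std_vec_in_Z2n by blast
    moreover have "ip a (std_vec k) = a k" if "k \<in> {1..n}" for a k
    proof -
      have "ip a (std_vec k) = (\<Sum>i\<in>{1..n}. if i = k then a i else 0)"
        unfolding ip_def std_vec_def by (intro sum.cong) auto
      then show ?thesis using that by simp
    qed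
    ultimately have "a k = c k" for k
      using ac by (cases "k \<in> {1..n}") (auto simp: Z2n_def)
    then show "a = c \<and> b = d"
      using bd by blast
  qed
  then have "card (cut ` (Z2n n \<times> {0, 1})) = 2 ^ n * 2"
    by (simp add: card_image card_cartesian_product card_Z2n)
  \<comment> \<open>As \<open>S\<close> spans, there are \<open>2 ^ n\<close> subset sums, which
    leaves \<open>2 ^ (n + 1)\<close> zero-sum sets: as many as there are cuts. Hence every zero-sum
    set is a cut.\<close>
  moreover have "2 ^ n * card ?Z = 2 ^ n * (2 ^ n * 2)"
    using card_subset_sums [OF bit_fun_add_self fin] subset_sums_eq_group_closure [OF fin] span
    by (simp add: card_Z2n card power_add mult_2 flip: power_mult)
  moreover have "finite ?Z"
    using fin by (simp add: zero_sum_subsets_def)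
  ultimately have Z: "?Z = cut ` (Z2n n \<times> {0, 1})"
    using cut_zero_sum by (intro card_subset_eq [symmetric]) auto
  have "even (card (X \<inter> Y)) \<longleftrightarrow> even (card X) \<or> even (card Y)" if "X \<in> ?Z" "Y \<in> ?Z" for X Y
  proof -
    from that obtain p q where "X = cut p" "Y = cut q"
      unfolding Z by blast
    then show ?thesis
      by (cases p; cases q) (simp add: cut_card cut_Int)
  qed
  then show ?thesis
    using S by (simp add: theta_property_iff [OF fin])
qed

section \<open>Extremal sets\<close>

text \<open>Expanding the product leaves four sums over \<open>K\<close>. This evaluates the
  contribution of a translated piece of the basis to the orthogonality sums; \<open>v = 0\<close>
  covers the basis itself.\<close>

lemma sum_shifted_std_vec:
  assumes "finite K"
  shows "(\<Sum>k\<in>K. (v + std_vec k) i * (v + std_vec k) j)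
    = of_bool (odd (card K)) * v i * v j + v i * of_bool (j \<in> K) + v j * of_bool (i \<in> K)
      + of_bool (i = j \<and> i \<in> K)"
proof -
  have "(\<Sum>k\<in>K. (v + std_vec k) i * (v + std_vec k) j)
    = (\<Sum>k\<in>K. 1) * (v i * v j) + v i * (\<Sum>k\<in>K. std_vec k j) + v j * (\<Sum>k\<in>K. std_vec k i)
      + (\<Sum>k\<in>K. std_vec k i * std_vec k j)"
    unfolding sum_distrib_left sum_distrib_right sum.distrib [symmetric]
    by (intro sum.cong refl) (simp add: algebra_simps)
  moreover have "(\<Sum>k\<in>K. 1 :: bit) = of_bool (odd (card K))"
    using even_card_iff_sum [of K] by (cases "odd (card K)") auto
  moreover have "(\<Sum>k\<in>K. std_vec k i) = of_bool (i \<in> K)" for i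
    using sum_std_vec_apply [OF assms, of i] by (simp only: sum_fun_apply)
  moreover have "(\<Sum>k\<in>K. std_vec k i * std_vec k j) = of_bool (i = j \<and> i \<in> K)"
  proof -
    have "(\<Sum>k\<in>K. std_vec k i * std_vec k j) = (\<Sum>k\<in>K. if i = k then of_bool (i = j) else 0)"
      by (intro sum.cong refl) (auto simp: std_vec_def)
    then show ?thesis using assms by simp
  qed
  ultimately show ?thesis
    by (simp only: mult.assoc)
qed

lemma std_vec_eq_iff: "std_vec k = std_vec l \<longleftrightarrow> k = l"
proof
  assume "std_vec k = std_vec l"
  then have "std_vec k k = std_vec l k" by simp
  then show "k = l" by (simp add: std_vec_def split: if_splits)
qed simp

lemma inj_std_vec: "inj_on std_vec K"
  by (simp add: inj_on_def std_vec_eq_iff)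

lemma inj_shifted_std_vec: "inj_on (\<lambda>k. v + std_vec k) K"
  by (simp add: inj_on_def std_vec_eq_iff)

lemma sum_std_vec_images:
  "(\<Sum>s\<in>std_vec ` K. g s) = (\<Sum>k\<in>K. g (std_vec k))"
  "(\<Sum>s\<in>(\<lambda>k. v + std_vec k) ` K. g s) = (\<Sum>k\<in>K. g (v + std_vec k))"
  by (simp_all add: sum.reindex inj_std_vec inj_shifted_std_vec)

lemma sum_std_vec_products:
  "finite K \<Longrightarrow> (\<Sum>k\<in>K. std_vec k i * std_vec k j) = of_bool (i = j \<and> i \<in> K)"
  using sum_shifted_std_vec [of K 0 i j] by simp

lemma std_vec_apply: "std_vec k i = of_bool (i = k)"
  by (simp add: std_vec_def)

lemma fun_neqI: "v i \<noteq> w i \<Longrightarrow> v \<noteq> w"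
  by auto

text \<open>At such a coordinate \<open>std_vec k\<close> and \<open>std_vec l\<close> vanish while
  the all-ones vector does not, which separates \<open>std_vec k\<close> from the translate of
  \<open>std_vec l\<close>.\<close>

lemma exists_third_index:
  fixes k l n :: nat
  assumes "n \<ge> 3"
  obtains i where "i \<in> {1..n}" "i \<noteq> k" "i \<noteq> l"
proof -
  have "\<not> {1..n} \<subseteq> {k, l}"
    using assms card_mono [of "{k, l}" "{1..n}"] card_insert_le_m1 [of 2 "{l}" k] by auto
  then show ?thesis using that by blast
qed

text \<open>At coordinates in \<open>{1..n}\<close> the basis and its complements together
  contribute \<open>n\<close> modulo 2 to each orthogonality sum, so \<open>z\<close> must
  contribute the same: \<open>J\<close> for odd \<open>n\<close>, \<open>0\<close> for even
  \<open>n\<close>. The latter also covers \<open>n = 4\<close>.\<close>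

lemma theta_set_basis_complements:
  fixes n :: nat
  defines "J \<equiv> \<Sum>i\<in>{1..n}. std_vec i"
  defines "z \<equiv> if odd n then J else 0"
  defines "S \<equiv> std_vec ` {1..n} \<union> (\<lambda>k. J + std_vec k) ` {1..n} \<union> {z}"
  assumes n: "n \<ge> 3"
  shows "card S = 2 * n + 1" "group_closure S = Z2n n" "theta_property n S" "odd n \<Longrightarrow> 0 \<notin> S"
proof -
  have J: "J i = of_bool (i \<in> {1..n})" for i
    unfolding J_def by (rule sum_std_vec_apply) simp
  have zJ: "z i = of_bool (odd n \<and> i \<in> {1..n})" for i
    by (simp add: z_def J)
  have ne: "std_vec k \<noteq> J + std_vec l" for k l
  proof -
    obtain i where i: "i \<in> {1..n}" "i \<noteq> k" "i \<noteq> l" using n by (rule exists_third_index)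
    then show ?thesis by (intro fun_neqI [of _ i]) (simp add: std_vec_apply J)
  qed
  have ez: "std_vec k \<noteq> z" if "k \<in> {1..n}" for k
  proof -
    obtain i where i: "i \<in> {1..n}" "i \<noteq> k" using n by (rule exists_third_index)
    show ?thesis
    proof (cases "odd n")
      case True
      with i show ?thesis by (intro fun_neqI [of _ i]) (simp add: std_vec_apply zJ)
    next
      case False
      with that show ?thesis by (intro fun_neqI [of _ k]) (simp add: std_vec_apply zJ)
    qed
  qed
  have Jz: "J + std_vec k \<noteq> z" if "k \<in> {1..n}" for k
  proof -
    obtain i where i: "i \<in> {1..n}" "i \<noteq> k" using n by (rule exists_third_index)
    show ?thesis
    proof (cases "odd n")
      case True
      with that show ?thesis
        by (intro fun_neqI [of _ k]) (simp add: std_vec_apply zJ J bit_add_self)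
    next
      case False
      with i show ?thesis by (intro fun_neqI [of _ i]) (simp add: std_vec_apply zJ J)
    qed
  qed
  have disj: "std_vec ` {1..n} \<inter> (\<lambda>k. J + std_vec k) ` {1..n} = {}"
    "(std_vec ` {1..n} \<union> (\<lambda>k. J + std_vec k) ` {1..n}) \<inter> {z} = {}"
    using ne ez Jz by blast+
  \<comment> \<open>The target monoid is left general: over \<open>nat\<close> with constant
    \<open>1\<close> this gives the cardinality, over \<open>bit\<close> the orthogonality
    sums.\<close>
  have split: "(\<Sum>s\<in>S. g s) = (\<Sum>k\<in>{1..n}. g (std_vec k)) + (\<Sum>k\<in>{1..n}. g (J + std_vec k)) + g z"
    for g :: "(nat \<Rightarrow> bit) \<Rightarrow> 'b::comm_monoid_add"
    unfolding S_def sum_std_vec_images [symmetric] using disj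
    by (simp add: sum.union_disjoint ac_simps)
  show card: "card S = 2 * n + 1"
    using split [of "\<lambda>_. 1 :: nat"] by simp
  have sub: "S \<subseteq> Z2n n"
    by (auto simp: S_def Z2n_def zJ J std_vec_apply)
  then show span: "group_closure S = Z2n n"
    by (rule group_closure_eq_Z2nI) (simp add: S_def)
  have "(\<Sum>s\<in>S. s i * s j) = 0" for i j
    unfolding split sum_shifted_std_vec [OF finite_atLeastAtMost]
      sum_std_vec_products [OF finite_atLeastAtMost] J zJ
    by (cases "i \<in> {1..n}"; cases "j \<in> {1..n}"; cases "i = j"; cases "odd n")
      (simp_all add: bit_add_self)
  with span card show "theta_property n S"
    by (rule theta_propertyI)
  have "std_vec k \<noteq> 0" "J + std_vec k \<noteq> 0" if "k \<in> {1..n}" for k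
  proof -
    show "std_vec k \<noteq> 0"
      by (intro fun_neqI [of _ k]) (simp add: std_vec_apply)
    obtain i where i: "i \<in> {1..n}" "i \<noteq> k" using n by (rule exists_third_index)
    then show "J + std_vec k \<noteq> 0"
      by (intro fun_neqI [of _ i]) (simp add: std_vec_apply J)
  qed
  moreover have "z \<noteq> 0" if "odd n"
    using n that by (intro fun_neqI [of _ 1]) (simp add: zJ)
  ultimately show "0 \<notin> S" if "odd n"
    using that by (fastforce simp: S_def)
qed

text \<open>With \<open>u\<close> the indicator of \<open>{1, 2, 3}\<close> one has
  \<open>J = u + L\<close>. In the orthogonality sum the terms \<open>u i * u j\<close> and
  \<open>L i * L j\<close> each cancel in pairs, and the diagonal terms add up to
  \<open>J i + u i + L i = 0\<close>.\<close>

lemma theta_set_even: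
  fixes n :: nat
  defines "J \<equiv> \<Sum>i\<in>{1..n}. std_vec i"
  defines "L \<equiv> \<Sum>i\<in>{4..n}. std_vec i"
  defines "P \<equiv> {std_vec 1 + std_vec 2, std_vec 1 + std_vec 3, std_vec 2 + std_vec 3, L}"
  defines "S \<equiv> std_vec ` {1..n} \<union> P \<union> (\<lambda>k. J + std_vec k) ` {4..n}"
  assumes n: "n \<ge> 6" "even n"
  shows "card S = 2 * n + 1" "theta_property n S" "0 \<notin> S"
proof -
  have J: "J i = of_bool (i \<in> {1..n})" for i
    unfolding J_def by (rule sum_std_vec_apply) simp
  have L: "L i = of_bool (i \<in> {4..n})" for i
    unfolding L_def by (rule sum_std_vec_apply) simp
  let ?a = "std_vec 1 + std_vec 2" and ?b = "std_vec 1 + std_vec 3" and ?c = "std_vec 2 + std_vec 3"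
  have "std_vec k \<notin> P" for k
  proof -
    \<comment> \<open>A vector with two nonzero coordinates is no basis vector.\<close>
    have "std_vec k \<noteq> v" if "v i = 1" "v j = 1" "i \<noteq> j" for v i j
    proof
      assume "std_vec k = v"
      then have "std_vec k i = 1" "std_vec k j = 1" using that by auto
      with \<open>i \<noteq> j\<close> show False by (auto simp: std_vec_apply split: if_splits)
    qed
    from this [of ?a 1 2] this [of ?b 1 3] this [of ?c 2 3] this [of L 4 5]
    show ?thesis using n by (simp add: P_def std_vec_apply L)
  qed
  moreover have "std_vec k \<noteq> J + std_vec l" if "l \<in> {4..n}" for k l
  proof -
    obtain i where i: "i \<in> {1..n}" "i \<noteq> k" "i \<noteq> l"
      by (rule exists_third_index [of n]) (use n in auto)
    then show ?thesis by (intro fun_neqI [of _ i]) (simp add: std_vec_apply J)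
  qed
  moreover have "J + std_vec k \<notin> P" if k: "k \<in> {4..n}" for k
  proof -
    \<comment> \<open>Within \<open>{1..n}\<close> the complement of \<open>std_vec k\<close>
      vanishes only at \<open>k \<ge> 4\<close>, whereas each member of \<open>P\<close> vanishes at
      some coordinate among 1, 2, 3.\<close>
    have "J + std_vec k \<noteq> v" if "i \<in> {1..n}" "i \<noteq> k" "v i = 0" for v i
      by (rule fun_neqI [of _ i]) (use that in \<open>simp add: std_vec_apply J\<close>)
    from this [of 3 ?a] this [of 2 ?b] this [of 1 ?c] this [of 1 L]
    show ?thesis using n k by (simp add: P_def std_vec_apply L)
  qed
  ultimately have disj: "std_vec ` {1..n} \<inter> P = {}"
    "(std_vec ` {1..n} \<union> P) \<inter> (\<lambda>k. J + std_vec k) ` {4..n} = {}"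
    by blast+
  have distinct: "?a \<noteq> ?b" "?a \<noteq> ?c" "?b \<noteq> ?c" "?a \<noteq> L" "?b \<noteq> L" "?c \<noteq> L"
    using fun_neqI [of ?a 2 ?b] fun_neqI [of ?a 1 ?c] fun_neqI [of ?b 1 ?c]
      fun_neqI [of ?a 2 L] fun_neqI [of ?b 3 L] fun_neqI [of ?c 3 L]
    by (simp_all add: std_vec_apply L)
  have split: "(\<Sum>s\<in>S. g s) = (\<Sum>k\<in>{1..n}. g (std_vec k)) + (g ?a + (g ?b + (g ?c + g L)))
      + (\<Sum>k\<in>{4..n}. g (J + std_vec k))"
    for g :: "(nat \<Rightarrow> bit) \<Rightarrow> 'b::comm_monoid_add"
  proof -
    have "finite P" "(\<Sum>s\<in>P. g s) = g ?a + (g ?b + (g ?c + g L))"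
      using distinct by (simp_all add: P_def)
    then show ?thesis
      unfolding S_def sum_std_vec_images [symmetric] using disj
      by (simp add: sum.union_disjoint)
  qed
  show card: "card S = 2 * n + 1"
    using split [of "\<lambda>_. 1 :: nat"] n by simp
  have "S \<subseteq> Z2n n"
    using n by (auto simp: S_def P_def Z2n_def L J std_vec_apply)
  then have span: "group_closure S = Z2n n"
    by (rule group_closure_eq_Z2nI) (simp add: S_def)
  define u :: "nat \<Rightarrow> bit" where "u i = of_bool (i \<in> {1, 2, 3})" for i
  have J_split: "J i = u i + L i" for i
    using n by (cases "i \<in> {1, 2, 3}") (auto simp: J L u_def)
  have triangle: "?a i * ?a j + (?b i * ?b j + ?c i * ?c j) = u i * u j + of_bool (i = j) * u i" for i j
    by (cases "i = 1"; cases "i = 2"; cases "i = 3"; cases "j = 1"; cases "j = 2"; cases "j = 3")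
      (simp_all add: std_vec_apply u_def)
  have "(\<Sum>s\<in>S. s i * s j) = 0" for i j
  proof -
    \<comment> \<open>The block has \<open>n - 3\<close> elements, an odd number, so the term
      \<open>J i * J j\<close> survives.\<close>
    have "odd (card {4..n})"
      using n by simp
    then have "(\<Sum>s\<in>S. s i * s j) = of_bool (i = j) * J i
        + ((?a i * ?a j + (?b i * ?b j + ?c i * ?c j)) + L i * L j)
        + (J i * J j + J i * L j + J j * L i + of_bool (i = j) * L i)"
      unfolding split sum_shifted_std_vec [OF finite_atLeastAtMost]
        sum_std_vec_products [OF finite_atLeastAtMost] of_bool_conj J [symmetric] L [symmetric]
      by (simp only: of_bool_eq simp_thms mult_1_left add.assoc)
    also have "\<dots> = 0"
      unfolding triangle J_split
      by (cases "u i"; cases "u j"; cases "L i"; cases "L j"; cases "i = j")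
        (simp_all add: bit_add_self)
    finally show ?thesis .
  qed
  with span card show "theta_property n S"
    by (rule theta_propertyI)
  have nz: "v \<noteq> 0" if "v i = 1" for v :: "nat \<Rightarrow> bit" and i
    using that by auto
  have "std_vec k \<noteq> 0" for k
    by (rule nz [of _ k]) (simp add: std_vec_apply)
  moreover have "0 \<notin> P"
    using nz [of ?a 1] nz [of ?b 1] nz [of ?c 2] nz [of L 4] n
    by (auto simp: P_def std_vec_apply L)
  moreover have "J + std_vec k \<noteq> 0" if "k \<in> {4..n}" for k
    by (rule nz [of _ 1]) (use that n in \<open>simp add: std_vec_apply J\<close>)
  ultimately show "0 \<notin> S"
    by (auto simp: S_def)
qed

lemma M_Theta_eq:
  assumes "n \<ge> 3"
  shows "M_Theta n = 2 * n + 1"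
  unfolding M_Theta_def
proof (rule Max_eqI [OF finite_theta_cards])
  \<comment> \<open>The basis with its complements and \<open>z\<close> attains the bound for both
    parities of \<open>n\<close>; for even \<open>n\<close> this set contains
    \<open>0\<close>.\<close>
  show "2 * n + 1 \<in> {card S |S. group_closure S = Z2n n \<and> theta_property n S}"
    by (intro CollectI exI conjI)
      (fact theta_set_basis_complements(1) [OF assms, symmetric]
        theta_set_basis_complements(2,3) [OF assms])+
qed (use theta_property_card_le in fastforce)

theorem theorem6p3:
  shows "(\<forall>n\<ge>3. M_Theta n = 2 * n + 1) \<and>
    (\<forall>n\<ge>3. odd n \<longrightarrow>
      (let e = std_vec; J = (\<Sum>i\<in>{1..n}. e i);
           S = {e k |k. k \<in> {1..n}} \<union> {J + e k |k. k \<in> {1..n}} \<union> {J}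
       in theta_property n S \<and> 0 \<notin> S \<and> card S = 2 * n + 1)) \<and>
    (\<forall>n\<ge>6. even n \<longrightarrow>
      (let e = std_vec; J = (\<Sum>i\<in>{1..n}. e i);
           S = {e k |k. k \<in> {1..n}}
             \<union> {e 1 + e 2, e 1 + e 3, e 2 + e 3, (\<Sum>i\<in>{4..n}. e i)}
             \<union> {J + e k |k. k \<in> {4..n}}
       in theta_property n S \<and> 0 \<notin> S \<and> card S = 2 * n + 1)) \<and>
    (let e = std_vec; J = (\<Sum>i\<in>{1..4}. e i);
         S = {e 1, e 2, e 3, e 4} \<union> {J + e 1, J + e 2, J + e 3, J + e 4} \<union> {0}
     in theta_property 4 S \<and> card S = 9)"
proof -
  have four: "f ` {1..4} = {f 1, f 2, f 3, f 4}" for f :: "nat \<Rightarrow> nat \<Rightarrow> bit"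
  proof -
    have "{1..4} = {1, 2, 3, 4 :: nat}"
      by auto
    then show ?thesis
      by simp
  qed
  show ?thesis
    unfolding Let_def Setcompr_eq_image
  proof (intro conjI allI impI, goal_cases)
    case (1 n)
    then show ?case by (rule M_Theta_eq)
  next
    case (2 n)
    then show ?case using theta_set_basis_complements(3) [of n] by simp
  next
    case (3 n)
    then show ?case using theta_set_basis_complements(4) [of n] by simp
  next
    case (4 n)
    then show ?case using theta_set_basis_complements(1) [of n] by simp
  next
    case (5 n)
    then show ?case using theta_set_even(2) [of n] by simp
  next
    case (6 n)
    then show ?case using theta_set_even(3) [of n] by simp
  next
    case (7 n)
    then show ?case using theta_set_even(1) [of n] by simp
  next
    \<comment> \<open>For \<open>n = 4\<close> the extra vector \<open>z\<close> is
      \<open>0\<close>, and \<open>four\<close> lists the images explicitly.\<close>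
    case 8
    show ?case using theta_set_basis_complements(3) [of 4] unfolding four by simp
  next
    case 9
    show ?case using theta_set_basis_complements(1) [of 4] unfolding four by simp
  qed
qed

end
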